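(* Fix positive integers $d$ and $k$. As $a$ ranges over the positive integers relatively prime to $k$, the genus $g\left(\langle a,a+k\rangle/d\right)$ is a quasipolynomial in $a$ of degree $2$ with leading coefficient $\frac{1}{2d}$. That is, there exist periodic functions $c_0,c_1:\mathbb{Z}\to\mathbb{Q}$ (depending on $d$ and $k$) such that for every positive integer $a$ with $\gcd(a,k)=1$, $$g\left(\langle a,a+k\rangle/d\right)=\frac{1}{2d}a^2+c_1(a)\,a+c_0(a).$$
   Context: $\mathbb{N}$ denotes the set of nonnegative integers. A numerical semigroup is a subset of $\mathbb{N}$ that is closed under addition, contains $0$, and has finite complement in $\mathbb{N}$. For relatively prime positive integers $a,b$, $\langle a,b\rangle=\{c_1a+c_2b: c_1,c_2\in\mathbb{N}\}$, which is a numerical semigroup. For a numerical semigroup $S$ and a positive integer $d$, $S/d=\{x\in\mathbb{N}: dx\in S\}$, which is again a numerical semigroup. The genus of a numerical semigroup $S$ is $g(S)=|\mathbb{N}\setminus S|$. A quasipolynomial of degree $n$ in $x$ is a function of the form $c_n(x)x^n+c_{n-1}(x)x^{n-1}+\cdots+c_0(x)$ whose coefficients $c_i(x)$ are periodic functions of $x$. *)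

theory Defs
  imports Complex_Main "HOL-Library.Periodic_Fun" "HOL-Number_Theory.Cong"
begin

definition numerical_semigroup :: "nat set \<Rightarrow> bool" where
  "numerical_semigroup S \<longleftrightarrow>
     0 \<in> S \<and> (\<forall>x\<in>S. \<forall>y\<in>S. x + y \<in> S) \<and> finite (- S)"

definition generated2 :: "nat \<Rightarrow> nat \<Rightarrow> nat set" where
  "generated2 a b = {c1 * a + c2 * b | c1 c2. True}"

definition quotient_by :: "nat set \<Rightarrow> nat \<Rightarrow> nat set" where
  "quotient_by S d = {x. d * x \<in> S}"

(* Meaningful for numerical semigroups, whose complement is finite. *)
definition genus :: "nat set \<Rightarrow> nat" where
  "genus S = card (- S)"

(* The library locale does not by itself exclude the period 0. *)
definition periodic :: "(int \<Rightarrow> 'a) \<Rightarrow> bool" where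
  "periodic f \<longleftrightarrow> (\<exists>p>0. periodic_fun_simple f p)"

lemma numerical_semigroup_generated2:
  assumes "a > 0" "b > 0" "coprime a b"
  shows "numerical_semigroup (generated2 a b)"
proof -
  have "n \<in> generated2 a b" if n: "a * b \<le> n" for n
  proof -
    obtain x where "[a * x = Suc 0] (mod b)"
      using cong_solve_coprime_nat[OF \<open>coprime a b\<close>] by auto
    then have "[a * x * n = Suc 0 * n] (mod b)"
      by (rule cong_scalar_right)
    then have "[a * (x * n mod b) = n] (mod b)"
      by (simp add: cong_def mod_mult_right_eq mult.assoc)
    moreover have "a * (x * n mod b) \<le> n"
      using n \<open>b > 0\<close> by (meson le_trans less_imp_le mod_less_divisor mult_le_mono2)
    ultimately have "b dvd n - a * (x * n mod b)"
      by (simp add: cong_altdef_nat cong_sym_eq)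
    then obtain y where "n - a * (x * n mod b) = b * y" ..
    with \<open>a * (x * n mod b) \<le> n\<close> have "n = (x * n mod b) * a + y * b"
      by (simp add: algebra_simps)
    then show ?thesis unfolding generated2_def by blast
  qed
  then have "- generated2 a b \<subseteq> {..<a * b}"
    by (auto simp: not_le[symmetric])
  then have "finite (- generated2 a b)"
    by (rule finite_subset) simp
  moreover have "0 \<in> generated2 a b"
    unfolding generated2_def by force
  moreover have "x + y \<in> generated2 a b"
    if "x \<in> generated2 a b" "y \<in> generated2 a b" for x y
  proof -
    from that obtain p q r s where "x = p * a + q * b" "y = r * a + s * b"
      unfolding generated2_def by blast
    then have "x + y = (p + r) * a + (q + s) * b"
      by (simp add: algebra_simps)
    then show ?thesis unfolding generated2_def by blast
  qed
  ultimately show ?thesis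
    unfolding numerical_semigroup_def by blast
qed

lemma numerical_semigroup_quotient_by:
  assumes "numerical_semigroup S" "d > 0"
  shows "numerical_semigroup (quotient_by S d)"
proof -
  have "- quotient_by S d = (\<lambda>x. d * x) -` (- S)"
    by (auto simp: quotient_by_def)
  moreover have "finite ((\<lambda>x. d * x) -` (- S))"
    using assms by (intro finite_vimageI) (auto simp: numerical_semigroup_def inj_def)
  ultimately show ?thesis
    using assms by (auto simp: numerical_semigroup_def quotient_by_def distrib_left)
qed

end

theory Submission
  imports Defs
begin

text \<open>
  Let \<open>a\<close> be coprime to \<open>k\<close>. Every integer has exactly one representation \<open>n = m a + j k\<close> with
  \<open>0 \<le> j < a\<close> and \<open>m\<close> an integer, and \<open>n\<close> lies in \<open>\<langle>a, a + k\<rangle>\<close> iff \<open>j \<le> m\<close>, because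
  \<open>n = (m - j) a + j (a + k)\<close>. So the genus of \<open>\<langle>a, a + k\<rangle> / d\<close>, which is the number of gaps
  divisible by \<open>d\<close>, is the number of lattice points \<open>(j, m)\<close> with \<open>0 \<le> j < a\<close>, \<open>m < j\<close>,
  \<open>m a + j k \<ge> 0\<close> and \<open>d\<close> dividing \<open>m a + j k\<close> (lemma \<open>genus_eq_card_normal_forms\<close>).

  Split these points by the sign of \<open>m\<close>. Those with \<open>m \<ge> 0\<close> fill a triangle of side \<open>a\<close>, subject to
  a condition of period \<open>d\<close> in \<open>j\<close> and in \<open>m\<close>. Those with \<open>m < 0\<close> lie on the \<open>k - 1\<close> lines \<open>m = -r\<close>,
  \<open>1 \<le> r < k\<close>, and on such a line \<open>j\<close> runs through the interval from \<open>r a / k\<close> to \<open>a\<close>. Now replace \<open>a\<close>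
  by \<open>a + d k\<close>. The divisibility conditions do not change, and the end points of each interval move
  by the multiples \<open>r d\<close> and \<open>k d\<close> of the period; so the count on a line grows by a constant, whereas
  the count in the triangle has the constant second difference \<open>k\<^sup>2 N\<close>, where \<open>N\<close> is the number of
  solutions of \<open>m a + j k \<equiv> 0\<close> modulo \<open>d\<close>. Since \<open>a\<close> and \<open>k\<close> are coprime, \<open>N = d\<close>
  (lemma \<open>card_linear_congruence_solutions\<close>).

  Hence the genus has second difference \<open>d k\<^sup>2\<close> for the step \<open>d k\<close>. On each residue class modulo
  \<open>d k\<close> it is therefore a quadratic polynomial, with leading coefficient
  \<open>d k\<^sup>2 / (2 (d k)\<^sup>2) = 1 / (2 d)\<close>.
\<close>

section \<open>Functions with constant second difference\<close>

text \<open>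
  After subtraction of the quadratic term the second difference vanishes, so along each residue
  class modulo \<open>M\<close> the rest is an arithmetic progression, determined by its values at the least
  element of the class and at the next one. The predicate \<open>P\<close> singles out the residue classes on
  which the recurrence is known.
\<close>
lemma quasipolynomial_if_second_difference_constant:
  fixes F :: "nat \<Rightarrow> 'a :: field_char_0" and K :: 'a
  assumes M: "M > 0"
    and P: "\<And>n. P (n + M) \<longleftrightarrow> P n"
    and F: "\<And>n. P n \<Longrightarrow> F (n + 2 * M) + F n = 2 * F (n + M) + K"
  shows "\<exists>c0 c1 :: int \<Rightarrow> 'a. periodic c0 \<and> periodic c1 \<and>
    (\<forall>n. P n \<longrightarrow> F n = K / (2 * of_nat M ^ 2) * of_nat n ^ 2
                       + c1 (int n) * of_nat n + c0 (int n))"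
proof -
  define G where "G n = F n - K / (2 * of_nat M ^ 2) * of_nat n ^ 2" for n
  have G_second_diff: "G (n + 2 * M) + G n = 2 * G (n + M)" if "P n" for n
  proof -
    define c where "c = K / (2 * of_nat M ^ 2)"
    have "K = 2 * c * of_nat M ^ 2" using M by (simp add: c_def)
    then show ?thesis
      using F[OF that] unfolding G_def c_def[symmetric]
      by (simp add: algebra_simps power2_eq_square)
  qed
  have P_shift: "P (n + t * M) \<longleftrightarrow> P n" for n t
  proof (induction t)
    case (Suc t)
    then show ?case using P[of "n + t * M"] by (simp add: algebra_simps)
  qed simp
  have G_line: "G (n + t * M) = G n + of_nat t * (G (n + M) - G n)" if "P n" for n t
  proof (induction t rule: induct_nat_012)
    case (ge2 t)
    have step: "G (n + Suc (Suc t) * M) = 2 * G (n + Suc t * M) - G (n + t * M)"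
    proof -
      have "n + Suc (Suc t) * M = n + t * M + 2 * M" "n + Suc t * M = n + t * M + M" by simp_all
      then show ?thesis
        using G_second_diff[of "n + t * M"] P_shift that by (simp only: eq_diff_eq)
    qed
    show ?case unfolding step ge2 by (simp add: algebra_simps)
  qed simp_all
  define res where "res x = nat (x mod int M)" for x :: int
  define c1 where "c1 x = (G (res x + M) - G (res x)) / of_nat M" for x
  define c0 where "c0 x = G (res x) - c1 x * of_nat (res x)" for x
  have res_shift: "res (x + int M) = res x" for x
    unfolding res_def by simp
  have "periodic c1"
    unfolding periodic_def using M
    by (intro exI[of _ "int M"] conjI) (auto intro!: periodic_fun_simple.intro simp: c1_def res_shift)
  moreover have "periodic c0"
    unfolding periodic_def using M
    by (intro exI[of _ "int M"] conjI)
       (auto intro!: periodic_fun_simple.intro simp: c0_def c1_def res_shift)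
  moreover have "F n = K / (2 * of_nat M ^ 2) * of_nat n ^ 2 + c1 (int n) * of_nat n + c0 (int n)"
    if "P n" for n
  proof -
    define r where "r = n mod M"
    define t where "t = n div M"
    have n: "n = r + t * M" by (simp add: r_def t_def)
    have res: "res (int n) = r" by (simp add: res_def r_def flip: zmod_int)
    have "P r" using that P_shift n by simp
    then have "G n = G r + of_nat t * (G (r + M) - G r)"
      using G_line n by simp
    also have "\<dots> = c1 (int n) * of_nat n + c0 (int n)"
      using M unfolding c0_def c1_def res by (simp add: n field_simps)
    finally show ?thesis unfolding G_def by (simp add: algebra_simps)
  qed
  ultimately show ?thesis by blast
qed

section \<open>Sums of periodic functions over intervals and triangles\<close>

lemma sum_periodic_window:
  fixes f :: "nat \<Rightarrow> nat"
  assumes f: "\<And>i. f (i + p) = f i"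
  shows "sum f {l..<l + q * p} = q * sum f {..<p}"
proof -
  have period: "sum f {l..<l + p} = sum f {..<p}" for l
  proof (induction l)
    case (Suc l)
    have "sum f {l..<l + p} + f (l + p) = f l + sum f {Suc l..<Suc l + p}"
      using sum.atLeastLessThan_Suc[of l "l + p" f] sum.atLeast_Suc_lessThan[of l "Suc (l + p)" f]
      by simp
    with Suc f show ?case by simp
  qed (simp add: atLeast0LessThan)
  show ?thesis
  proof (induction q)
    case (Suc q)
    have "sum f {l..<l + Suc q * p}
        = sum f {l..<l + q * p} + sum f {l + q * p..<l + q * p + p}"
      by (subst sum.atLeastLessThan_concat) (simp_all add: algebra_simps)
    with Suc period show ?case by simp
  qed simp
qed

lemma sum_lessThan_add:
  fixes f :: "nat \<Rightarrow> 'a :: comm_monoid_add"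
  shows "sum f {..<n + l} = sum f {..<n} + sum f {n..<n + l}"
  by (simp add: sum.atLeastLessThan_concat flip: atLeast0LessThan)

text \<open>
  The \<open>j\<close>-th row sum \<open>w j\<close> grows under \<open>j \<mapsto> j + q p\<close> by \<open>q\<close> full periods of the row. Therefore the
  two consecutive strips of \<open>q p\<close> rows from row \<open>n\<close> on differ by the sum over \<open>q \<times> q\<close> full
  period squares.
\<close>
lemma sum_triangle_second_difference:
  fixes f :: "nat \<Rightarrow> nat \<Rightarrow> nat"
  assumes f1: "\<And>j m. f (j + p) m = f j m" and f2: "\<And>j m. f j (m + p) = f j m"
  defines "T \<equiv> \<lambda>n. \<Sum>j<n. \<Sum>m<j. f j m"
  shows "T (n + 2 * (q * p)) + T n = 2 * T (n + q * p) + q ^ 2 * (\<Sum>j<p. \<Sum>m<p. f j m)"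
proof -
  define w where "w j = (\<Sum>m<j. f j m)" for j
  have f1': "f (j + q * p) m = f j m" for j m
    by (induction q) (use f1[of "j + _ * p"] in \<open>simp_all add: algebra_simps\<close>)
  have w: "w (j + q * p) = w j + q * (\<Sum>m<p. f j m)" for j
    unfolding w_def f1' sum_lessThan_add
    by (simp add: sum_periodic_window[of "f j", OF f2])
  have T1: "T (l + q * p) = T l + sum w {l..<l + q * p}" for l
    unfolding T_def w_def by (rule sum_lessThan_add)
  have "sum w {n + q * p..<n + q * p + q * p} = (\<Sum>j\<in>{n..<n + q * p}. w (j + q * p))"
    by (rule sum.shift_bounds_nat_ivl)
  also have "\<dots> = sum w {n..<n + q * p} + q * (\<Sum>j\<in>{n..<n + q * p}. \<Sum>m<p. f j m)"
    by (simp add: w sum.distrib sum_distrib_left)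
  also have "(\<Sum>j\<in>{n..<n + q * p}. \<Sum>m<p. f j m) = q * (\<Sum>j<p. \<Sum>m<p. f j m)"
    by (rule sum_periodic_window) (simp add: f1)
  finally have "T (n + q * p + q * p) + T n = 2 * T (n + q * p) + q ^ 2 * (\<Sum>j<p. \<Sum>m<p. f j m)"
    unfolding T1[of "n + q * p"] T1[of n] by (simp add: power2_eq_square)
  then show ?thesis by (simp add: mult_2 add.assoc)
qed

section \<open>Solutions of a linear congruence in two unknowns\<close>

text \<open>
  A Bezout relation \<open>u a + v k = 1\<close> makes \<open>(j, m) \<mapsto> (m a + j k, u j - v m)\<close> a map of determinant
  \<open>\<plusminus>1\<close>, hence a bijection modulo \<open>d\<close>. The solutions are the points whose first image coordinate is
  \<open>0\<close>, so the second coordinate \<open>t\<close> parametrises them, with inverse \<open>t \<mapsto> (a t, - k t)\<close>.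
\<close>
lemma card_linear_congruence_solutions:
  fixes a k d :: nat
  assumes "coprime a k" "d > 0"
  shows "card {(j, m). j < d \<and> m < d \<and> d dvd m * a + j * k} = d"
proof -
  obtain u v :: int where uv: "u * int a + v * int k = 1"
    using \<open>coprime a k\<close> bezout_int[of "int a" "int k"] by (auto simp: coprime_iff_gcd_eq_1)
  define S where "S = {(j, m). j < d \<and> m < d \<and> d dvd m * a + j * k}"
  have of_nat_nat_mod: "int (nat (x mod int d)) = x mod int d" for x
    using \<open>d > 0\<close> by simp
  define f where "f t = (nat (int a * int t mod int d), nat (- int k * int t mod int d))" for t
  define g where "g = (\<lambda>(j, m). nat ((u * int j - v * int m) mod int d))"
  have "bij_betw f {..<d} S"
  proof (rule bij_betw_byWitness[where f' = g])
    have "[u * (int a * int t mod int d) - v * (- int k * int t mod int d) = int t] (mod int d)" for t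
    proof -
      have "[u * (int a * int t mod int d) - v * (- int k * int t mod int d)
            = u * (int a * int t) - v * (- int k * int t)] (mod int d)"
        by (intro cong_diff cong_scalar_left) (simp_all add: cong_def)
      also have "u * (int a * int t) - v * (- int k * int t) = (u * int a + v * int k) * int t"
        by (simp add: algebra_simps)
      finally show ?thesis by (simp add: uv)
    qed
    then show "\<forall>t\<in>{..<d}. g (f t) = t"
      using \<open>d > 0\<close> by (auto simp: f_def g_def cong_def)
  next
    show "\<forall>p\<in>S. f (g p) = p"
    proof safe
      fix j m assume "(j, m) \<in> S"
      then have jm: "j < d" "m < d" and "int d dvd int (m * a + j * k)"
        unfolding S_def of_nat_dvd_iff by auto
      then have dvd: "int d dvd int m * int a + int j * int k" by simp
      have "int a * (u * int j - v * int m) - int j = - v * (int m * int a + int j * int k)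
          + (u * int a + v * int k - 1) * int j" by (simp add: algebra_simps)
      then have 1: "[int a * (u * int j - v * int m) = int j] (mod int d)"
        using dvd uv by (simp add: cong_iff_dvd_diff)
      have "- int k * (u * int j - v * int m) - int m = - u * (int m * int a + int j * int k)
          + (u * int a + v * int k - 1) * int m" by (simp add: algebra_simps)
      then have 2: "[- int k * (u * int j - v * int m) = int m] (mod int d)"
        using dvd uv by (simp add: cong_iff_dvd_diff)
      show "f (g (j, m)) = (j, m)"
        using 1 2 jm \<open>d > 0\<close> unfolding f_def g_def cong_def
        by (simp only: prod.case of_nat_nat_mod mod_mult_right_eq) simp
    qed
  next
    have "int d dvd (- int k * int t mod int d) * int a + (int a * int t mod int d) * int k" for t
    proof -
      have "[(- int k * int t mod int d) * int a + (int a * int t mod int d) * int k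
          = (- int k * int t) * int a + (int a * int t) * int k] (mod int d)"
        by (intro cong_add cong_scalar_right) (simp_all add: cong_def)
      then show ?thesis by (simp add: algebra_simps cong_0_iff)
    qed
    then show "f ` {..<d} \<subseteq> S"
      using \<open>d > 0\<close> by (auto simp: f_def S_def nat_less_iff simp flip: of_nat_dvd_iff[where 'a = int])
  next
    show "g ` S \<subseteq> {..<d}"
      using \<open>d > 0\<close> by (auto simp: g_def nat_less_iff)
  qed
  then show ?thesis using bij_betw_same_card unfolding S_def by fastforce
qed

section \<open>Gaps of \<open>\<langle>a, a + k\<rangle>\<close> as lattice points\<close>

text \<open>
  In a representation \<open>c1 a + c2 (a + k)\<close> of \<open>n\<close>, the coefficient \<open>c2\<close> is congruent to \<open>j\<close> modulo \<open>a\<close>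
  and hence exceeds it by \<open>q a\<close> with \<open>q \<ge> 0\<close>. Trading \<open>q a\<close> copies of \<open>a + k\<close> for \<open>q (a + k)\<close> copies
  of \<open>a\<close> yields the representation with \<open>c2 = j\<close>, so that one exists iff any does.
\<close>
lemma mem_generated2_iff:
  fixes a k j n :: nat and m :: int
  assumes "coprime a k" "j < a" and n: "int n = m * int a + int j * int k"
  shows "n \<in> generated2 a (a + k) \<longleftrightarrow> int j \<le> m"
proof
  assume "n \<in> generated2 a (a + k)"
  then obtain c1 c2 where "n = c1 * a + c2 * (a + k)" by (auto simp: generated2_def)
  then have eq: "(int c1 + int c2) * int a + int c2 * int k = m * int a + int j * int k"
    using n by (simp add: algebra_simps)
  then have "(int c2 - int j) * int k = (m - int c1 - int c2) * int a"
    by (simp add: algebra_simps)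
  then have "int a dvd (int c2 - int j) * int k" by simp
  then have "int a dvd int c2 - int j"
    using \<open>coprime a k\<close> by (simp add: coprime_dvd_mult_left_iff)
  then obtain q where q: "int c2 = int j + int a * q" by (auto simp: dvd_def algebra_simps)
  \<comment> \<open>A negative \<open>q\<close> would give \<open>c2 \<le> j - a < 0\<close>.\<close>
  have "q \<ge> 0"
  proof (rule ccontr)
    assume "\<not> q \<ge> 0"
    then have "int a * q \<le> int a * (-1)" by (intro mult_left_mono) auto
    with q \<open>j < a\<close> show False by simp
  qed
  have "(int c1 + int c2 + q * int k) * int a = m * int a"
    using eq unfolding q by (simp add: algebra_simps)
  then have "m = int c1 + int c2 + q * int k" using \<open>j < a\<close> by simp
  moreover have "int j \<le> int c2" using q \<open>q \<ge> 0\<close> by simp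
  moreover have "0 \<le> q * int k" using \<open>q \<ge> 0\<close> by simp
  ultimately show "int j \<le> m" by linarith
next
  assume "int j \<le> m"
  then have "int n = int (nat (m - int j) * a + j * (a + k))"
    unfolding n by (simp add: algebra_simps)
  then show "n \<in> generated2 a (a + k)" unfolding generated2_def of_nat_eq_iff by blast
qed

lemma ex_normal_form:
  fixes a k n :: nat
  assumes "coprime a k" "a > 0"
  obtains j :: nat and m :: int where "j < a" "int n = m * int a + int j * int k"
proof -
  obtain x where "[k * x = Suc 0] (mod a)"
    using cong_solve_coprime_nat[of k a] \<open>coprime a k\<close> by (auto simp: coprime_commute)
  then have "[k * x * n = Suc 0 * n] (mod a)" by (rule cong_scalar_right)
  then have "[k * (x * n mod a) = n] (mod a)"
    by (simp add: cong_def mod_mult_right_eq mult.assoc)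
  then have "[int n = int (k * (x * n mod a))] (mod int a)"
    by (simp only: cong_int_iff cong_sym_eq)
  then obtain m where "int n - int (k * (x * n mod a)) = int a * m"
    by (auto simp: cong_iff_dvd_diff)
  then have "int n = m * int a + int (x * n mod a) * int k" by (simp add: algebra_simps)
  with \<open>a > 0\<close> show thesis by (intro that[of "x * n mod a" m]) simp_all
qed

lemma normal_form_unique:
  fixes a k j j' :: nat and m m' :: int
  assumes "coprime a k" "j < a" "j' < a" and eq: "m * int a + int j * int k = m' * int a + int j' * int k"
  shows "j = j' \<and> m = m'"
proof -
  have "(int j - int j') * int k = (m' - m) * int a" using eq by (simp add: algebra_simps)
  then have "int a dvd (int j - int j') * int k" by simp
  then have "int a dvd int j - int j'"
    using \<open>coprime a k\<close> by (simp add: coprime_dvd_mult_left_iff)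
  then have "[int j = int j'] (mod int a)" by (simp add: cong_iff_dvd_diff)
  then have "j = j'" using assms(2,3) by (simp add: cong_int_iff cong_less_modulus_unique_nat)
  with eq assms(2) show ?thesis by simp
qed

lemma genus_eq_card_normal_forms:
  fixes a d k :: nat
  assumes "coprime a k" "a > 0" "d > 0"
  shows "genus (quotient_by (generated2 a (a + k)) d) =
    card {(j, m). j < a \<and> m < int j \<and> 0 \<le> m * int a + int j * int k
                  \<and> int d dvd m * int a + int j * int k}"
    (is "_ = card ?G")
proof -
  define f where "f = (\<lambda>(j, m). nat ((m * int a + int j * int k) div int d))"
  have f: "int (d * f (j, m)) = m * int a + int j * int k" if "(j, m) \<in> ?G" for j m
    using that \<open>d > 0\<close> by (simp add: f_def pos_imp_zdiv_nonneg_iff)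
  have "inj_on f ?G"
  proof (rule inj_onI)
    fix p p' assume "p \<in> ?G" "p' \<in> ?G" "f p = f p'"
    moreover obtain j m j' m' where "p = (j, m)" "p' = (j', m')" by (metis surj_pair)
    ultimately show "p = p'"
      using f[of j m] f[of j' m'] normal_form_unique[OF \<open>coprime a k\<close>, of j j' m m'] by auto
  qed
  moreover have "f ` ?G = - quotient_by (generated2 a (a + k)) d"
  proof (intro equalityI subsetI)
    fix x assume "x \<in> f ` ?G"
    then obtain j m where jm: "(j, m) \<in> ?G" and x: "x = f (j, m)" by auto
    then show "x \<in> - quotient_by (generated2 a (a + k)) d"
      using mem_generated2_iff[OF \<open>coprime a k\<close> _ f[OF jm]] by (auto simp: quotient_by_def)
  next
    fix x assume x: "x \<in> - quotient_by (generated2 a (a + k)) d"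
    obtain j m where jm: "j < a" "int (d * x) = m * int a + int j * int k"
      using ex_normal_form[OF assms(1,2)] by blast
    then have "m < int j"
      using x mem_generated2_iff[OF \<open>coprime a k\<close> jm] by (auto simp: quotient_by_def)
    moreover have "0 \<le> m * int a + int j * int k" "int d dvd m * int a + int j * int k"
      by (simp_all flip: jm(2))
    ultimately have G: "(j, m) \<in> ?G" using jm(1) by simp
    have "d * x = d * f (j, m)"
      unfolding of_nat_eq_iff[where 'a = int, symmetric] using f[OF G] jm(2) by (simp only:)
    then have "x = f (j, m)" using \<open>d > 0\<close> by simp
    with G show "x \<in> f ` ?G" by (rule image_eqI[rotated])
  qed
  ultimately show ?thesis
    unfolding genus_def using card_image[of f ?G] by (simp only:)
qed

text \<open>
  The gaps \<open>m a + j k\<close> divisible by \<open>d\<close> with \<open>m \<ge> 0\<close>. Here \<open>m a + j k \<ge> 0\<close> holds automatically.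
\<close>
definition nonneg_gaps :: "nat \<Rightarrow> nat \<Rightarrow> nat \<Rightarrow> nat" where
  "nonneg_gaps d k a = (\<Sum>j<a. \<Sum>m<j. of_bool (d dvd m * a + j * k))"

text \<open>
  The gaps \<open>- r a + j k\<close> divisible by \<open>d\<close>, on the line \<open>m = - r\<close>. The congruence expresses the
  divisibility of the difference \<open>j k - r a\<close> without subtraction.
\<close>
definition neg_gaps :: "nat \<Rightarrow> nat \<Rightarrow> nat \<Rightarrow> nat \<Rightarrow> nat" where
  "neg_gaps d k r a = (\<Sum>j<a. of_bool (r * a \<le> j * k \<and> [j * k = r * a] (mod d)))"

text \<open>
  The lines \<open>m = - r\<close> with \<open>r \<ge> k\<close> carry no gaps, since \<open>r a \<le> j k\<close> would force \<open>j \<ge> a\<close>.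
\<close>
lemma genus_eq_gap_counts:
  fixes a d k :: nat
  assumes "coprime a k" "a > 0" "d > 0" "k > 0"
  shows "genus (quotient_by (generated2 a (a + k)) d)
    = nonneg_gaps d k a + (\<Sum>r\<in>{1..<k}. neg_gaps d k r a)"
proof -
  define A where "A = (SIGMA j:{..<a}. {m. m < j \<and> d dvd m * a + j * k})"
  define B where "B = (SIGMA r:{1..<k}. {j. j < a \<and> r * a \<le> j * k \<and> [j * k = r * a] (mod d)})"
  define fA where "fA = (\<lambda>(j :: nat, m). (j, int m))"
  define fB where "fB = (\<lambda>(r, j :: nat). (j, - int r))"
  define G where "G = {(j, m). j < a \<and> m < int j \<and> 0 \<le> m * int a + int j * int k
                  \<and> int d dvd m * int a + int j * int k}"
  have A_G: "(j, m) \<in> fA ` A \<longleftrightarrow> (j, m) \<in> G" if "m \<ge> 0" for j m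
  proof -
    from that obtain i where i: "m = int i" by (metis nonneg_int_cases)
    have "int d dvd int i * int a + int j * int k \<longleftrightarrow> d dvd i * a + j * k"
      by (simp flip: of_nat_dvd_iff[where 'a = int])
    then show ?thesis unfolding i by (auto simp: fA_def A_def G_def image_iff)
  qed
  have B_G: "(j, m) \<in> fB ` B \<longleftrightarrow> (j, m) \<in> G" if "m < 0" for j m
  proof -
    from that obtain r where r: "m = - int r" "r > 0" by (metis neg_int_cases)
    have "[j * k = r * a] (mod d) \<longleftrightarrow> int d dvd m * int a + int j * int k"
      by (simp add: r flip: cong_int_iff) (simp add: cong_iff_dvd_diff)
    moreover have "0 \<le> m * int a + int j * int k \<longleftrightarrow> r * a \<le> j * k"
      by (simp add: r flip: of_nat_mult)
    moreover have "r < k" if "r * a \<le> j * k" "j < a"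
    proof (rule ccontr)
      assume "\<not> r < k"
      then have "k * a \<le> r * a" by simp
      also note that(1)
      also have "j * k < k * a" using that \<open>k > 0\<close> by simp
      finally show False by simp
    qed
    ultimately show ?thesis using r by (auto simp: fB_def B_def G_def image_iff)
  qed
  have A_iff: "p \<in> fA ` A \<longleftrightarrow> p \<in> G \<and> snd p \<ge> 0" for p
  proof -
    have "snd p \<ge> 0" if "p \<in> fA ` A" using that by (auto simp: fA_def)
    then show ?thesis using A_G[of "snd p" "fst p"] by auto
  qed
  have B_iff: "p \<in> fB ` B \<longleftrightarrow> p \<in> G \<and> snd p < 0" for p
  proof -
    have "snd p < 0" if "p \<in> fB ` B" using that by (auto simp: fB_def B_def)
    then show ?thesis using B_G[of "snd p" "fst p"] by auto
  qed
  have G: "G = fA ` A \<union> fB ` B"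
    by (rule set_eqI, simp only: Un_iff A_iff B_iff, linarith)
  have disj: "fA ` A \<inter> fB ` B = {}"
    by (rule equals0I, simp only: Int_iff A_iff B_iff, linarith)
  have fin: "finite A" "finite B" unfolding A_def B_def by auto
  have "inj_on fA A" "inj_on fB B" by (auto simp: inj_on_def fA_def fB_def)
  then have "card G = card A + card B"
    using disj fin unfolding G by (simp add: card_Un_disjoint card_image)
  moreover have "card A = nonneg_gaps d k a"
  proof -
    have "{m. m < j \<and> d dvd m * a + j * k} = {..<j} \<inter> {m. d dvd m * a + j * k}" for j by auto
    then show ?thesis unfolding A_def nonneg_gaps_def by (simp add: sum_of_bool_eq)
  qed
  moreover have "card B = (\<Sum>r\<in>{1..<k}. neg_gaps d k r a)"
  proof -
    have "{j. j < a \<and> r * a \<le> j * k \<and> [j * k = r * a] (mod d)}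
        = {..<a} \<inter> {j. r * a \<le> j * k \<and> [j * k = r * a] (mod d)}" for r by auto
    then show ?thesis unfolding B_def neg_gaps_def by (simp add: sum_of_bool_eq)
  qed
  ultimately show ?thesis
    using genus_eq_card_normal_forms[OF assms(1-3)] unfolding G_def by simp
qed

section \<open>Second differences of the gap counts\<close>

lemma cong_add_multiple_nat:
  fixes x y d :: nat
  shows "[x + d * u = y + d * v] (mod d) \<longleftrightarrow> [x = y] (mod d)"
  by (simp add: cong_def)

lemma nonneg_gaps_second_difference:
  assumes "coprime a k" "d > 0"
  shows "nonneg_gaps d k (a + 2 * (d * k)) + nonneg_gaps d k a
       = 2 * nonneg_gaps d k (a + d * k) + d * k ^ 2"
proof -
  define f :: "nat \<Rightarrow> nat \<Rightarrow> nat" where "f j m = of_bool (d dvd m * a + j * k)" for j m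
  have dvd_shift: "d dvd m * (a + t * d) + j * k \<longleftrightarrow> d dvd m * a + j * k" for j m t
  proof -
    have "m * (a + t * d) + j * k = (m * a + j * k) + d * (m * t)" by (simp add: algebra_simps)
    then show ?thesis by (metis dvd_add_left_iff dvd_triv_left)
  qed
  have T: "nonneg_gaps d k (a + t * d) = (\<Sum>j<a + t * d. \<Sum>m<j. f j m)" for t
    unfolding nonneg_gaps_def f_def dvd_shift ..
  have f1: "f (j + d) m = f j m" for j m
  proof -
    have "m * a + (j + d) * k = (m * a + j * k) + d * k" by (simp add: algebra_simps)
    then show ?thesis unfolding f_def by (simp only: dvd_add_left_iff dvd_triv_left)
  qed
  have f2: "f j (m + d) = f j m" for j m
  proof -
    have "(m + d) * a + j * k = (m * a + j * k) + d * a" by (simp add: algebra_simps)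
    then show ?thesis unfolding f_def by (simp only: dvd_add_left_iff dvd_triv_left)
  qed
  have "(\<Sum>j<d. \<Sum>m<d. f j m) = (\<Sum>j<d. card {m. m < d \<and> d dvd m * a + j * k})"
    unfolding f_def by (simp add: sum_of_bool_eq Collect_conj_eq lessThan_def)
  also have "\<dots> = card (SIGMA j:{..<d}. {m. m < d \<and> d dvd m * a + j * k})"
    by simp
  also have "(SIGMA j:{..<d}. {m. m < d \<and> d dvd m * a + j * k})
      = {(j, m). j < d \<and> m < d \<and> d dvd m * a + j * k}" by auto
  also have "card \<dots> = d" using assms by (rule card_linear_congruence_solutions)
  finally have N: "(\<Sum>j<d. \<Sum>m<d. f j m) = d" .
  show ?thesis
    using sum_triangle_second_difference[of f d a k, OF f1 f2] T[of 0] T[of k] T[of "2 * k"]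
    by (simp add: N algebra_simps)
qed

text \<open>
  Besides the translation of \<open>j\<close> by \<open>r d\<close>, which carries the condition for \<open>a + d k\<close> to the one for
  \<open>a\<close>, the interval gets \<open>k - r\<close> further full periods at its upper end. There the inequality
  \<open>r a \<le> j k\<close> holds because of \<open>r \<le> k\<close> and \<open>a \<le> j\<close>.
\<close>
lemma neg_gaps_add_period:
  assumes "r \<le> k"
  shows "neg_gaps d k r (a + d * k)
       = neg_gaps d k r a + (k - r) * (\<Sum>j<d. of_bool ([j * k = r * a] (mod d)))"
proof -
  define h :: "nat \<Rightarrow> nat"
    where "h j = of_bool (r * (a + d * k) \<le> j * k \<and> [j * k = r * (a + d * k)] (mod d))" for j
  define g :: "nat \<Rightarrow> nat"
    where "g j = of_bool (r * a \<le> j * k \<and> [j * k = r * a] (mod d))" for j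
  define e :: "nat \<Rightarrow> nat" where "e j = of_bool ([j * k = r * a] (mod d))" for j
  have len: "a + d * k = r * d + (a + (k - r) * d)"
    using assms by (metis add.left_commute add_mult_distrib le_add_diff_inverse mult.commute)
  have "h j = 0" if "j < r * d" for j
  proof (cases "k = 0")
    case True
    with assms that show ?thesis by simp
  next
    case False
    with that have "j * k < r * d * k" by simp
    also have "\<dots> \<le> r * (a + d * k)" by (simp add: algebra_simps)
    finally show ?thesis by (simp add: h_def)
  qed
  moreover have "h (j + r * d) = g j" for j
  proof -
    have "[(j + r * d) * k = r * (a + d * k)] (mod d) \<longleftrightarrow> [j * k = r * a] (mod d)"
      using cong_add_multiple_nat[of "j * k" d "r * k" "r * a" "r * k"] by (simp add: algebra_simps)
    then show ?thesis unfolding h_def g_def by (simp add: algebra_simps)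
  qed
  ultimately have "sum h {..<r * d + (a + (k - r) * d)} = sum g {..<a + (k - r) * d}"
    using sum.shift_bounds_nat_ivl[of h 0 "r * d" "a + (k - r) * d"]
    by (simp add: sum_lessThan_add atLeast0LessThan add.commute)
  moreover have "neg_gaps d k r (a + d * k) = sum h {..<a + d * k}"
    unfolding neg_gaps_def h_def ..
  ultimately have "neg_gaps d k r (a + d * k) = sum g {..<a + (k - r) * d}"
    unfolding len by simp
  also have "\<dots> = neg_gaps d k r a + sum g {a..<a + (k - r) * d}"
    unfolding sum_lessThan_add neg_gaps_def g_def ..
  also have "sum g {a..<a + (k - r) * d} = sum e {a..<a + (k - r) * d}"
  proof (rule sum.cong)
    fix j assume "j \<in> {a..<a + (k - r) * d}"
    then have "a * r \<le> j * k" using assms by (intro mult_le_mono) auto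
    then show "g j = e j" by (simp add: g_def e_def mult.commute)
  qed simp
  also have "\<dots> = (k - r) * sum e {..<d}"
  proof (rule sum_periodic_window)
    show "e (j + d) = e j" for j
      using cong_add_multiple_nat[of "j * k" d k "r * a" 0] by (simp add: e_def algebra_simps)
  qed
  finally show ?thesis unfolding e_def .
qed

text \<open>
  The increment over one period depends on \<open>a\<close> modulo \<open>d\<close> only, so it is the same for \<open>a\<close> and
  \<open>a + d k\<close>.
\<close>
lemma neg_gaps_second_difference:
  assumes "r \<le> k"
  shows "neg_gaps d k r (a + 2 * (d * k)) + neg_gaps d k r a = 2 * neg_gaps d k r (a + d * k)"
proof -
  have "[j * k = r * (a + d * k)] (mod d) \<longleftrightarrow> [j * k = r * a] (mod d)" for j
    using cong_add_multiple_nat[of "j * k" d 0 "r * a" "r * k"] by (simp add: algebra_simps)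
  then have "neg_gaps d k r (a + d * k + d * k) + neg_gaps d k r a = 2 * neg_gaps d k r (a + d * k)"
    unfolding neg_gaps_add_period[OF assms] by simp
  then show ?thesis by (simp add: mult_2 add.assoc)
qed

theorem corollary2p3:
  fixes d k :: nat
  assumes "d > 0" and "k > 0"
  shows "\<exists>c0 c1 :: int \<Rightarrow> rat. periodic c0 \<and> periodic c1 \<and>
    (\<forall>a::nat. a > 0 \<and> coprime a k \<longrightarrow>
       of_nat (genus (quotient_by (generated2 a (a + k)) d)) =
         1 / (2 * of_nat d) * of_nat a ^ 2 + c1 (int a) * of_nat a + c0 (int a))"
proof -
  define R where "R a = nonneg_gaps d k a + (\<Sum>r\<in>{1..<k}. neg_gaps d k r a)" for a
  have "R (a + 2 * (d * k)) + R a = 2 * R (a + d * k) + d * k ^ 2" if "coprime a k" for a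
  proof -
    have "(\<Sum>r\<in>{1..<k}. neg_gaps d k r (a + 2 * (d * k))) + (\<Sum>r\<in>{1..<k}. neg_gaps d k r a)
        = 2 * (\<Sum>r\<in>{1..<k}. neg_gaps d k r (a + d * k))"
      by (simp add: neg_gaps_second_difference sum_distrib_left flip: sum.distrib)
    then show ?thesis
      using nonneg_gaps_second_difference[OF that \<open>d > 0\<close>] unfolding R_def by simp
  qed
  then have "rat_of_nat (R (a + 2 * (d * k)) + R a) = rat_of_nat (2 * R (a + d * k) + d * k ^ 2)"
    if "coprime a k" for a using that by (simp only:)
  then have second_diff: "rat_of_nat (R (a + 2 * (d * k))) + rat_of_nat (R a)
      = 2 * rat_of_nat (R (a + d * k)) + rat_of_nat (d * k ^ 2)"
    if "coprime a k" for a using that by simp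
  have coprime_shift: "coprime (a + d * k) k \<longleftrightarrow> coprime a k" for a
    using gcd_add_mult[of k d a] by (simp add: coprime_iff_gcd_eq_1 gcd.commute add.commute)
  have lead: "rat_of_nat (d * k ^ 2) / (2 * rat_of_nat (d * k) ^ 2) = 1 / (2 * rat_of_nat d)"
    using assms by (simp add: field_simps power2_eq_square)
  obtain c0 c1 :: "int \<Rightarrow> rat" where "periodic c0" "periodic c1"
    and "\<And>a. coprime a k \<Longrightarrow> rat_of_nat (R a)
         = 1 / (2 * rat_of_nat d) * rat_of_nat a ^ 2 + c1 (int a) * rat_of_nat a + c0 (int a)"
    using quasipolynomial_if_second_difference_constant[of "d * k" "\<lambda>a. coprime a k"
        "\<lambda>a. rat_of_nat (R a)", OF _ coprime_shift second_diff] assms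
    unfolding lead by auto
  moreover have "genus (quotient_by (generated2 a (a + k)) d) = R a" if "a > 0" "coprime a k" for a
    using genus_eq_gap_counts that assms unfolding R_def by blast
  ultimately show ?thesis by (intro exI[of _ c0] exI[of _ c1]) simp
qed

end
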